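(* Let $p,q,r\in\mathbb{R}$. The polynomial $x^3+px^2+qx+r$ is a Ramanujan cubic polynomial if and only if it has the form $$\rho(h,s,x)=x^3+hsx^2-(h+3)s^2x+s^3$$ for some $h,s\in\mathbb{R}$ with $s\neq 0$.
   Context: A Ramanujan cubic polynomial (RCP) is a cubic polynomial $x^3+px^2+qx+r$ with $p,q,r\in\mathbb{R}$, $r\neq 0$, all of whose zeros are real and whose coefficients satisfy $p\,r^{1/3}+3\,r^{2/3}+q=0$. Here $r^{1/3}$ denotes the real cube root and $r^{2/3}=(r^{1/3})^2$. *)

theory Defs
  imports Complex_Main "HOL-Computational_Algebra.Polynomial"
begin

definition all_zeros_real :: "real poly \<Rightarrow> bool" where
  "all_zeros_real P \<longleftrightarrow> (\<forall>z::complex. poly (map_poly complex_of_real P) z = 0 \<longrightarrow> z \<in> \<real>)"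

(* Coefficient lists are in ascending order: [:r, q, p, 1:] is x^3 + p x^2 + q x + r.
   root 3 is the real cube root also for negative r, with root 3 r having the sign of r. *)
definition Ramanujan_cubic :: "real poly \<Rightarrow> bool" where
  "Ramanujan_cubic P \<longleftrightarrow>
     (\<exists>p q r. P = [:r, q, p, 1:] \<and> r \<noteq> 0 \<and> all_zeros_real P \<and>
              p * root 3 r + 3 * (root 3 r)\<^sup>2 + q = 0)"

definition rho :: "real \<Rightarrow> real \<Rightarrow> real poly" where
  "rho h s = [:s ^ 3, - (h + 3) * s\<^sup>2, h * s, 1:]"

end

theory Submission
  imports Defs
begin

text \<open>The roots of \<open>\<rho>(h,s,x)\<close> are permuted by \<open>x \<mapsto> s\<^sup>2 / (s - x)\<close>, a map of order 3 with real
  coefficients. Two roots \<open>z\<close>, \<open>w\<close> are therefore equal or linked by this map or its inverse.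
  Taking \<open>w\<close> to be the conjugate of a root \<open>z\<close>, each of the three cases forces \<open>z\<close>
  to be real, because \<open>z * cnj z\<close> is.\<close>

text \<open>The identity eliminates \<open>h\<close> between the equations of the two roots.\<close>

lemma rho_roots_related:
  fixes h s z w :: "'a::idom"
  assumes "z^3 + h * s * z^2 - (h + 3) * s^2 * z + s^3 = 0"
    and "w^3 + h * s * w^2 - (h + 3) * s^2 * w + s^3 = 0"
  shows "w = z \<or> (s - z) * w = s^2 \<or> (s - w) * z = s^2"
proof -
  have "(w - z) * ((s - z) * w - s^2) * ((s - w) * z - s^2)
      = z * (z - s) * (w^3 + h * s * w^2 - (h + 3) * s^2 * w + s^3)
        - w * (w - s) * (z^3 + h * s * z^2 - (h + 3) * s^2 * z + s^3)"
    by algebra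
  with assms show ?thesis by auto
qed

lemma poly_rho_of_real:
  "poly (map_poly complex_of_real (rho h s)) z =
     z^3 + of_real h * of_real s * z^2 - (of_real h + 3) * of_real s^2 * z + of_real s^3"
  by (simp add: rho_def map_poly_pCons power2_eq_square power3_eq_cube algebra_simps)

text \<open>This supplies the one condition on a Ramanujan cubic that is not a direct comparison of
  coefficients.\<close>

lemma all_zeros_real_rho:
  assumes "s \<noteq> 0"
  shows "all_zeros_real (rho h s)"
  unfolding all_zeros_real_def
proof (intro allI impI)
  fix z :: complex
  assume "poly (map_poly complex_of_real (rho h s)) z = 0"
  then have z: "z^3 + of_real h * of_real s * z^2 - (of_real h + 3) * of_real s^2 * z
      + of_real s^3 = 0"
    by (simp only: poly_rho_of_real)
  \<comment> \<open>The coefficients are real, so conjugation turns the equation of \<open>z\<close>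
    into that of \<open>cnj z\<close>.\<close>
  from arg_cong[OF z, of cnj]
  have "cnj z^3 + of_real h * of_real s * cnj z^2 - (of_real h + 3) * of_real s^2 * cnj z
      + of_real s^3 = 0"
    by simp
  from rho_roots_related[OF z this]
  consider "cnj z = z" | "(of_real s - z) * cnj z = of_real s^2"
    | "(of_real s - cnj z) * z = of_real s^2"
    by blast
  then have "Im z = 0"
  proof cases
    case 1
    then show ?thesis by (simp add: complex_eq_iff)
  next
    case 2
    \<comment> \<open>The imaginary part of the left side is \<open>- s * Im z\<close>, and
      \<open>s\<close> is nonzero.\<close>
    from arg_cong[OF this, of Im] assms show ?thesis
      by (simp add: power2_eq_square algebra_simps)
  next
    case 3
    from arg_cong[OF this, of Im] assms show ?thesis
      by (simp add: power2_eq_square algebra_simps)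
  qed
  then show "z \<in> \<real>" by (simp add: complex_is_Real_iff)
qed

theorem corollary4:
  fixes p q r :: real
  shows "Ramanujan_cubic [:r, q, p, 1:] \<longleftrightarrow>
         (\<exists>h s::real. s \<noteq> 0 \<and> [:r, q, p, 1:] = rho h s)"
proof
  assume "Ramanujan_cubic [:r, q, p, 1:]"
  then have r: "r \<noteq> 0" and rel: "p * root 3 r + 3 * (root 3 r)\<^sup>2 + q = 0"
    unfolding Ramanujan_cubic_def by auto
  \<comment> \<open>The constant term forces \<open>s^3 = r\<close>, and then the coefficient of x^2
    forces \<open>h = p / s\<close>; the cubic's relation settles \<open>q\<close>.\<close>
  define s where "s = root 3 r"
  have s: "s \<noteq> 0" "s^3 = r"
    using r by (auto simp: s_def odd_real_root_pow)
  have "q = - (p / s + 3) * s\<^sup>2"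
  proof -
    have "(p / s + 3) * s\<^sup>2 = p * s + 3 * s\<^sup>2"
      using s(1) by (simp add: field_simps power2_eq_square)
    with rel show ?thesis unfolding s_def[symmetric] mult_minus_left by linarith
  qed
  with s have "[:r, q, p, 1:] = rho (p / s) s"
    by (simp add: rho_def)
  with s(1) show "\<exists>h s. s \<noteq> 0 \<and> [:r, q, p, 1:] = rho h s" by blast
next
  assume "\<exists>h s. s \<noteq> 0 \<and> [:r, q, p, 1:] = rho h s"
  then obtain h s where s: "s \<noteq> 0" and eq: "[:r, q, p, 1:] = rho h s" by blast
  then have coeffs: "r = s^3" "q = - (h + 3) * s\<^sup>2" "p = h * s"
    by (simp_all add: rho_def)
  have "root 3 r = s"
    by (simp add: coeffs(1) odd_real_root_power_cancel)
  \<comment> \<open>The sum becomes \<open>h * s^2 + 3 * s^2 - (h + 3) * s^2\<close>.\<close>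
  then have "p * root 3 r + 3 * (root 3 r)\<^sup>2 + q = 0"
    by (simp add: coeffs power2_eq_square algebra_simps)
  moreover have "all_zeros_real [:r, q, p, 1:]"
    using all_zeros_real_rho[OF s] by (simp only: eq)
  moreover have "r \<noteq> 0" using s coeffs(1) by simp
  ultimately show "Ramanujan_cubic [:r, q, p, 1:]"
    unfolding Ramanujan_cubic_def by blast
qed

end
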